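(* Let $\mathsf d$ be the geodesic distance of hyperbolic space $\mathbb H^d_{-\kappa_d^2}$, $\kappa_d>0$, and let $P$ be the law of the random point with geodesic polar coordinates $(R_d,U_d)$, where $U_d\sim\operatorname{Unif}(S^{d-1})$ is independent of $R_d>0$, $\rho_d=\mathbb E R_d$ and $\epsilon_d=\operatorname{sd}(R_d)$. Put $$\tau_d=\frac{\epsilon_d}{\rho_d},\qquad s_d=\kappa_d\rho_d,\qquad \chi_d=s_d^2=\kappa_d^2\rho_d^2,\qquad \lambda_{d,\mathbb H}=\sqrt d\,\tau_dA(s_d),\qquad A(s)=s\coth s .$$ Under a change of length unit $\mathsf d'=c\,\mathsf d$ with $c>0$, let $\rho_d'=c\rho_d$, $\epsilon_d'=c\epsilon_d$ and $\kappa_d'=\kappa_d/c$, and let $\tau_d',s_d',\chi_d',\lambda_{d,\mathbb H}'$ be defined from $\rho_d',\epsilon_d',\kappa_d'$ by the same formulas. Then $$H_3(P,\mathsf d')=H_3(P,\mathsf d),\qquad \tau_d'=\tau_d,\qquad s_d'=s_d,\qquad \chi_d'=\chi_d,$$ and $\lambda_{d,\mathbb H}'=\lambda_{d,\mathbb H}$.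
   Context: Farthest-cell triplet entropy. Let $(\mathcal X,\mathsf d,P)$ be a metric probability space. Draw a query $X\sim P$ and a prototype triple $V=(V_1,V_2,V_3)\sim P^3$ independently. For fixed $v=(v_1,v_2,v_3)$ let $L_v(X)\in\arg\max_{1\le i\le3}\mathsf d(X,v_i)$ be the farthest-prototype label, with independent uniform randomization among exact ties. Put $q_i(v)=\mathbb P\{L_V(X)=i\mid V=v\}$, $q(v)=(q_1(v),q_2(v),q_3(v))$, and for a probability vector $q$ let $h(q)=-\sum_{i=1}^3q_i\log q_i$ (natural logarithm, $0\log0=0$). Then $H_3(P,\mathsf d)=\mathbb E_V\,h\{q(V)\}$. Here $d$ denotes the dimension and $\mathsf d$ the metric; $\mathbb H^d_{-\kappa^2}$ is the $d$-dimensional hyperbolic space of constant curvature $-\kappa^2$. *)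

theory Defs
  imports "HOL-Probability.Probability"
begin

subsection \<open>Farthest-cell triplet entropy\<close>

text \<open>
  Prototype triples are functions \<^term>\<open>v :: nat \<Rightarrow> 'a\<close> on the index set \<open>{1..3}\<close>. For a fixed query
  \<open>x\<close> the label is uniform on the set of maximisers of \<open>i \<mapsto> d x (v i)\<close>, which is the independent
  uniform randomization among exact ties.
\<close>

definition farthest_set :: "('a \<Rightarrow> 'a \<Rightarrow> real) \<Rightarrow> (nat \<Rightarrow> 'a) \<Rightarrow> 'a \<Rightarrow> nat set" where
  "farthest_set d v x = {i. is_arg_max (\<lambda>i. d x (v i)) (\<lambda>i. i \<in> {1..3}) i}"

definition farthest_label :: "('a \<Rightarrow> 'a \<Rightarrow> real) \<Rightarrow> (nat \<Rightarrow> 'a) \<Rightarrow> 'a \<Rightarrow> nat pmf" where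
  "farthest_label d v x = pmf_of_set (farthest_set d v x)"

text \<open>The law of the label of a random query drawn from \<open>P\<close>, for a fixed triple \<open>v\<close>.\<close>

definition label_law :: "'a measure \<Rightarrow> ('a \<Rightarrow> 'a \<Rightarrow> real) \<Rightarrow> (nat \<Rightarrow> 'a) \<Rightarrow> nat measure" where
  "label_law P d v = P \<bind> (\<lambda>x. measure_pmf (farthest_label d v x))"

definition cell_prob :: "'a measure \<Rightarrow> ('a \<Rightarrow> 'a \<Rightarrow> real) \<Rightarrow> (nat \<Rightarrow> 'a) \<Rightarrow> nat \<Rightarrow> real" where
  "cell_prob P d v i = measure (label_law P d v) {i}"

text \<open>As \<open>ln 0 = 0\<close>, the convention \<open>0 log 0 = 0\<close> holds.\<close>

definition shannon3 :: "(nat \<Rightarrow> real) \<Rightarrow> real" where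
  "shannon3 q = - (\<Sum>i\<in>{1..3}. q i * ln (q i))"

definition H3 :: "'a measure \<Rightarrow> ('a \<Rightarrow> 'a \<Rightarrow> real) \<Rightarrow> real" where
  "H3 P d = (\<integral>v. shannon3 (cell_prob P d v) \<partial>(Pi\<^sub>M {1..3} (\<lambda>_. P)))"

lemma farthest_set_eq:
  "farthest_set d v x = {i \<in> {1..3}. \<forall>j\<in>{1..3}. d x (v j) \<le> d x (v i)}"
  unfolding farthest_set_def is_arg_max_linorder by auto

lemma finite_farthest_set: "finite (farthest_set d v x)"
  unfolding farthest_set_eq by auto

lemma farthest_set_nonempty: "farthest_set d v x \<noteq> {}"
proof -
  have "Max ((\<lambda>i. d x (v i)) ` {1..3::nat}) \<in> (\<lambda>i. d x (v i)) ` {1..3}"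
    by (rule Max_in) auto
  then obtain i :: nat where i: "i \<in> {1..3}" "d x (v i) = Max ((\<lambda>i. d x (v i)) ` {1..3})"
    by force
  have "d x (v j) \<le> d x (v i)" if "j \<in> {1..3}" for j
    unfolding i(2) using that by (intro Max_ge) auto
  then show ?thesis
    using i(1) unfolding farthest_set_eq by blast
qed

lemma cell_prob_eq_integral:
  assumes P: "prob_space P"
    and d: "\<And>j. j \<in> {1..3} \<Longrightarrow> (\<lambda>x. d x (v j)) \<in> borel_measurable P"
  shows "cell_prob P d v i = (\<integral>x. indicator (farthest_set d v x) i / card (farthest_set d v x) \<partial>P)"
proof -
  interpret P: prob_space P by fact
  have S: "Measurable.pred P (\<lambda>x. farthest_set d v x = A)" for A
  proof -
    have "(farthest_set d v x = A) \<longleftrightarrow> A \<subseteq> {1..3} \<and>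
        (\<forall>i\<in>{1..3}. i \<in> A \<longleftrightarrow> (\<forall>j\<in>{1..3}. d x (v j) \<le> d x (v i)))" for x
      unfolding farthest_set_eq by blast
    moreover have "Measurable.pred P (\<lambda>x. d x (v j) \<le> d x (v i))"
      if "i \<in> {1..3}" "j \<in> {1..3}" for i j
      using d[OF that(1)] d[OF that(2)] by measurable
    ultimately show ?thesis
      by (simp only:) (intro pred_intros_logic pred_intros_finite; simp)
  qed
  have "farthest_set d v \<in> P \<rightarrow>\<^sub>M count_space (Pow {1..3})"
  proof (subst measurable_count_space_eq2, simp, intro conjI ballI)
    show "farthest_set d v \<in> space P \<rightarrow> Pow {1..3}" unfolding farthest_set_eq by auto
    show "farthest_set d v -` {A} \<inter> space P \<in> sets P" for A
      using S[of A] unfolding pred_def by (simp add: vimage_def Int_def conj_commute)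
  qed
  then have K: "(\<lambda>x. measure_pmf (farthest_label d v x)) \<in> P \<rightarrow>\<^sub>M subprob_algebra (count_space UNIV)"
    unfolding farthest_label_def
    by (rule measurable_compose) (auto intro!: measurable_count_space_eq1[THEN iffD2] 
        measure_pmf_in_subprob_algebra)
  have "cell_prob P d v i = (\<integral>x. measure (measure_pmf (farthest_label d v x)) {i} \<partial>P)"
    unfolding cell_prob_def label_law_def
    by (rule P.measure_bind[OF K]) auto
  also have "\<dots> = (\<integral>x. indicator (farthest_set d v x) i / card (farthest_set d v x) \<partial>P)"
    by (intro Bochner_Integration.integral_cong refl)
       (simp add: farthest_label_def measure_pmf_single pmf_of_set finite_farthest_set
         farthest_set_nonempty)
  finally show ?thesis .
qed


subsection \<open>Hyperbolic space of curvature \<open>-\<kappa>\<^sup>2\<close>\<close>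

text \<open>
  The hyperboloid model in \<open>\<real>\<^bsup>1,d\<^esup>\<close>, with \<open>d = CARD('n)\<close>: the upper sheet of the hyperboloid of
  radius \<open>1 / \<kappa>\<close> has constant curvature \<open>-\<kappa>\<^sup>2\<close> and geodesic distance \<open>hyp_dist \<kappa>\<close>. Outside
  \<open>hyp_space \<kappa>\<close> the value of \<open>hyp_dist \<kappa>\<close> has no meaning.
\<close>

definition lorentz :: "real \<times> (real^'n) \<Rightarrow> real \<times> (real^'n) \<Rightarrow> real" where
  "lorentz p q = fst p * fst q - snd p \<bullet> snd q"

definition hyp_space :: "real \<Rightarrow> (real \<times> (real^'n)) set" where
  "hyp_space \<kappa> = {p. fst p > 0 \<and> lorentz p p = 1 / \<kappa>\<^sup>2}"

definition hyp_dist :: "real \<Rightarrow> real \<times> (real^'n) \<Rightarrow> real \<times> (real^'n) \<Rightarrow> real" where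
  "hyp_dist \<kappa> p q = arcosh (\<kappa>\<^sup>2 * lorentz p q) / \<kappa>"

text \<open>
  Geodesic polar coordinates about the base point \<open>(1 / \<kappa>, 0)\<close>: the end point of the geodesic of
  length \<open>r\<close> that starts there in the direction \<open>u\<close>.
\<close>

definition hyp_polar :: "real \<Rightarrow> real \<Rightarrow> real^'n \<Rightarrow> real \<times> (real^'n)" where
  "hyp_polar \<kappa> r u = (cosh (\<kappa> * r) / \<kappa>, (sinh (\<kappa> * r) / \<kappa>) *\<^sub>R u)"

lemma hyp_polar_in_hyp_space:
  assumes "\<kappa> > 0" "norm u = 1"
  shows "hyp_polar \<kappa> r u \<in> hyp_space \<kappa>"
proof -
  have "u \<bullet> u = 1" using assms(2) by (simp add: norm_eq_1)
  moreover have "(cosh (\<kappa> * r))\<^sup>2 - (sinh (\<kappa> * r))\<^sup>2 = 1" by (rule hyperbolic_pythagoras)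
  ultimately show ?thesis
    using assms(1) unfolding hyp_space_def hyp_polar_def lorentz_def
    by (simp add: cosh_real_pos field_simps power2_eq_square)
qed

lemma hyp_dist_radial:
  assumes "\<kappa> > 0" "norm u = 1"
  shows "hyp_dist \<kappa> (hyp_polar \<kappa> r u) (hyp_polar \<kappa> s u) = \<bar>r - s\<bar>"
proof -
  have "u \<bullet> u = 1" using assms(2) by (simp add: norm_eq_1)
  then have "\<kappa>\<^sup>2 * lorentz (hyp_polar \<kappa> r u) (hyp_polar \<kappa> s u)
      = cosh (\<kappa> * r) * cosh (\<kappa> * s) - sinh (\<kappa> * r) * sinh (\<kappa> * s)"
    using assms(1) unfolding lorentz_def hyp_polar_def
    by (simp add: right_diff_distrib power2_eq_square)
  also have "\<dots> = cosh (\<kappa> * r - \<kappa> * s)"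
    by (rule cosh_diff[symmetric])
  also have "\<dots> = cosh \<bar>\<kappa> * r - \<kappa> * s\<bar>"
    by (rule cosh_real_abs[symmetric])
  also have "\<bar>\<kappa> * r - \<kappa> * s\<bar> = \<kappa> * \<bar>r - s\<bar>"
    using assms(1) by (simp add: abs_mult flip: right_diff_distrib)
  finally have "\<kappa>\<^sup>2 * lorentz (hyp_polar \<kappa> r u) (hyp_polar \<kappa> s u) = cosh (\<kappa> * \<bar>r - s\<bar>)" .
  then show ?thesis
    using assms(1) unfolding hyp_dist_def by (simp add: arcosh_cosh_real)
qed

text \<open>On \<open>hyp_space \<kappa>\<close> the distance is a metric.\<close>

lemma lorentz_commute: "lorentz p q = lorentz q p"
  unfolding lorentz_def by (simp add: inner_commute)

lemma lorentz_bilinear: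
  "lorentz (p + p') q = lorentz p q + lorentz p' q" "lorentz p (q + q') = lorentz p q + lorentz p q'"
  "lorentz (p - p') q = lorentz p q - lorentz p' q" "lorentz p (q - q') = lorentz p q - lorentz p q'"
  "lorentz (c *\<^sub>R p) q = c * lorentz p q" "lorentz p (c *\<^sub>R q) = c * lorentz p q"
  unfolding lorentz_def by (simp_all add: algebra_simps)

lemma hyp_space_scale:
  assumes "\<kappa> > 0" "p \<in> hyp_space \<kappa>"
  shows "\<kappa> *\<^sub>R p \<in> hyp_space 1"
  using assms unfolding hyp_space_def by (simp add: lorentz_bilinear power2_eq_square field_simps)

lemma lorentz_orth:
  assumes q: "q \<in> hyp_space 1" and w: "lorentz w q = 0"
  shows "lorentz w w \<le> 0" and "lorentz w w = 0 \<longleftrightarrow> w = 0"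
proof -
  have q2: "(fst q)\<^sup>2 = 1 + (norm (snd q))\<^sup>2" "fst q > 0"
    using q unfolding hyp_space_def lorentz_def
    by (auto simp: power2_eq_square dot_square_norm algebra_simps)
  have "fst w * fst q = snd w \<bullet> snd q"
    using w unfolding lorentz_def by simp
  then have "(fst w)\<^sup>2 * (fst q)\<^sup>2 \<le> (norm (snd w))\<^sup>2 * (norm (snd q))\<^sup>2"
    using Cauchy_Schwarz_ineq[of "snd w" "snd q"]
    by (simp add: power2_norm_eq_inner flip: power_mult_distrib)
  also have "\<dots> = (norm (snd w))\<^sup>2 * (fst q)\<^sup>2 - (norm (snd w))\<^sup>2"
    by (simp add: q2 algebra_simps)
  finally have *: "(norm (snd w))\<^sup>2 \<le> (- lorentz w w) * (fst q)\<^sup>2"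
    unfolding lorentz_def by (simp add: dot_square_norm power2_eq_square algebra_simps)
  have "0 \<le> (- lorentz w w) * (fst q)\<^sup>2"
    using * zero_le_power2 order_trans by blast
  then show "lorentz w w \<le> 0"
    using q2(2) by (simp add: mult_le_0_iff)
  show "lorentz w w = 0 \<longleftrightarrow> w = 0"
  proof
    assume z: "lorentz w w = 0"
    then have "snd w = 0" using * by simp
    then have "fst w = 0" using z unfolding lorentz_def by simp
    with \<open>snd w = 0\<close> show "w = 0" by (simp add: prod_eq_iff)
  qed (simp add: lorentz_def)
qed

lemma lorentz_orth_Cauchy_Schwarz:
  assumes q: "q \<in> hyp_space 1" and w: "lorentz w q = 0" and z: "lorentz z q = 0"
  shows "(lorentz w z)\<^sup>2 \<le> lorentz w w * lorentz z z"
proof (cases "z = 0")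
  case False
  then have neg: "lorentz z z < 0" using lorentz_orth[OF q z] by auto
  define y where "y = lorentz z z *\<^sub>R w - lorentz w z *\<^sub>R z"
  have "lorentz y q = 0"
    unfolding y_def by (simp add: lorentz_bilinear w z)
  then have "lorentz y y \<le> 0" by (rule lorentz_orth[OF q])
  moreover have "lorentz y y = lorentz z z * (lorentz w w * lorentz z z - (lorentz w z)\<^sup>2)"
    unfolding y_def
    by (simp add: lorentz_bilinear lorentz_commute[of z w] power2_eq_square algebra_simps)
  ultimately show ?thesis
    using neg by (simp add: mult_le_0_iff)
qed (simp add: lorentz_def)

lemma lorentz_ge_1:
  assumes p: "p \<in> hyp_space 1" and q: "q \<in> hyp_space 1"
  shows "lorentz p q \<ge> 1" and "lorentz p q = 1 \<longleftrightarrow> p = q"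
proof -
  define w where "w = p - lorentz p q *\<^sub>R q"
  have qq: "lorentz q q = 1" "lorentz p p = 1" using p q by (auto simp: hyp_space_def)
  have w: "lorentz w q = 0" "lorentz w w = 1 - (lorentz p q)\<^sup>2"
    unfolding w_def
    by (simp_all add: lorentz_bilinear qq lorentz_commute[of q p] power2_eq_square algebra_simps)
  have bd: "norm (snd x) < fst x" if "x \<in> hyp_space 1" for x :: "real \<times> (real^'n)"
  proof (rule power2_less_imp_less)
    show "(norm (snd x))\<^sup>2 < (fst x)\<^sup>2" "0 \<le> fst x"
      using that by (auto simp: hyp_space_def lorentz_def dot_square_norm power2_eq_square)
  qed
  have "snd p \<bullet> snd q \<le> norm (snd p) * norm (snd q)" by (rule norm_cauchy_schwarz)
  also have "\<dots> \<le> fst p * norm (snd q)"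
    using bd[OF p] by (intro mult_right_mono) auto
  also have "\<dots> < fst p * fst q"
    using bd[OF q] p by (intro mult_strict_left_mono) (auto simp: hyp_space_def)
  finally have pos: "lorentz p q > 0" unfolding lorentz_def by simp
  have "(lorentz p q)\<^sup>2 \<ge> 1" using lorentz_orth(1)[OF q w(1)] w(2) by simp
  then show "lorentz p q \<ge> 1"
    using pos by (auto intro: power2_le_imp_le[of 1 "lorentz p q"])
  show "lorentz p q = 1 \<longleftrightarrow> p = q"
    using lorentz_orth(2)[OF q w(1)] w(2) qq unfolding w_def by auto
qed

lemma hyp_dist_scale:
  "\<kappa> > 0 \<Longrightarrow> hyp_dist \<kappa> p q = hyp_dist 1 (\<kappa> *\<^sub>R p) (\<kappa> *\<^sub>R q) / \<kappa>"
  unfolding hyp_dist_def by (simp add: lorentz_bilinear power2_eq_square mult.assoc)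

lemma hyp_dist_metric:
  assumes "\<kappa> > 0" "p \<in> hyp_space \<kappa>" "q \<in> hyp_space \<kappa>" "r \<in> hyp_space \<kappa>"
  shows "hyp_dist \<kappa> p q \<ge> 0"
    and "hyp_dist \<kappa> p q = hyp_dist \<kappa> q p"
    and "hyp_dist \<kappa> p q = 0 \<longleftrightarrow> p = q"
    and "hyp_dist \<kappa> p r \<le> hyp_dist \<kappa> p q + hyp_dist \<kappa> q r"
proof -
  note sc = hyp_space_scale[OF assms(1)]
  have tri: "hyp_dist 1 p r \<le> hyp_dist 1 p q + hyp_dist 1 q r"
    if H: "p \<in> hyp_space 1" "q \<in> hyp_space 1" "r \<in> hyp_space 1"
    for p q r :: "real \<times> (real^'n)"
  proof -
    define a b where "a = lorentz p q" and "b = lorentz q r"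
    have ab: "a \<ge> 1" "b \<ge> 1" using lorentz_ge_1(1)[OF H(1,2)] lorentz_ge_1(1)[OF H(2,3)] by (simp_all add: a_def b_def)
    define w z where "w = p - a *\<^sub>R q" and "z = r - b *\<^sub>R q"
    have n: "lorentz p p = 1" "lorentz q q = 1" "lorentz r r = 1"
      using H by (auto simp: hyp_space_def)
    have c: "lorentz q p = a" "lorentz r q = b" "lorentz p q = a" "lorentz q r = b"
      by (auto simp: a_def b_def lorentz_commute)
    have o: "lorentz w q = 0" "lorentz z q = 0"
      unfolding w_def z_def by (simp_all add: lorentz_bilinear n c)
    have v: "lorentz w w = 1 - a\<^sup>2" "lorentz z z = 1 - b\<^sup>2" "lorentz w z = lorentz p r - a * b"
      unfolding w_def z_def
      by (simp_all add: lorentz_bilinear n c power2_eq_square algebra_simps)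
    have "(lorentz p r - a * b)\<^sup>2 \<le> (a\<^sup>2 - 1) * (b\<^sup>2 - 1)"
      using lorentz_orth_Cauchy_Schwarz[OF H(2) o] unfolding v by (simp add: algebra_simps)
    then have "lorentz p r - a * b \<le> sqrt (a\<^sup>2 - 1) * sqrt (b\<^sup>2 - 1)"
      by (simp add: real_le_rsqrt flip: real_sqrt_mult)
    then have "lorentz p r \<le> cosh (arcosh a + arcosh b)"
      using ab by (simp add: cosh_add sinh_arcosh_real)
    then have "cosh (arcosh (lorentz p r)) \<le> cosh (arcosh a + arcosh b)"
      using lorentz_ge_1[OF H(1,3)] by simp
    then show ?thesis
      using ab lorentz_ge_1[OF H(1,3)] unfolding hyp_dist_def
      by (subst (asm) cosh_real_nonneg_le_iff) (auto simp: a_def b_def)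
  qed
  show "hyp_dist \<kappa> p q = hyp_dist \<kappa> q p"
    unfolding hyp_dist_def by (simp add: lorentz_commute)
  have ge: "lorentz (\<kappa> *\<^sub>R p) (\<kappa> *\<^sub>R q) \<ge> 1" using lorentz_ge_1(1)[OF sc[OF assms(2)] sc[OF assms(3)]] .
  show "hyp_dist \<kappa> p q \<ge> 0"
    using ge assms(1) unfolding hyp_dist_scale[OF assms(1)] by (simp add: hyp_dist_def)
  show "hyp_dist \<kappa> p q = 0 \<longleftrightarrow> p = q"
    using ge assms(1) lorentz_ge_1(2)[OF sc[OF assms(2)] sc[OF assms(3)]]
    unfolding hyp_dist_scale[OF assms(1)] by (simp add: hyp_dist_def)
  show "hyp_dist \<kappa> p r \<le> hyp_dist \<kappa> p q + hyp_dist \<kappa> q r"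
    using tri[OF sc[OF assms(2)] sc[OF assms(3)] sc[OF assms(4)]] assms(1)
    unfolding hyp_dist_scale[OF assms(1)] by (simp add: field_simps)
qed


subsection \<open>The law of a random point with given polar coordinates\<close>

abbreviation sphere_borel :: "(real^'n) measure" where
  "sphere_borel \<equiv> restrict_space borel (sphere 0 1)"

text \<open>
  \<open>Unif(S\<^bsup>d-1\<^esup>)\<close> is the normalised cone measure, that is, the law of \<open>x / |x|\<close> for \<open>x\<close> uniform on the
  punctured unit ball. It is the rotation-invariant probability measure on the sphere.
\<close>

definition unif_sphere :: "(real^'n) measure" where
  "unif_sphere =
    (let B = ball 0 1 - {0}
     in distr (uniform_measure (restrict_space lborel B) B) sphere_borel (\<lambda>x. x /\<^sub>R norm x))"

text \<open>
  A probability measure on \<open>hyp_space \<kappa>\<close> with its Borel sigma-algebra, the law of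
  \<open>hyp_polar \<kappa> R U\<close>.
\<close>

definition hyp_polar_law ::
    "real \<Rightarrow> 'a measure \<Rightarrow> ('a \<Rightarrow> real) \<Rightarrow> ('a \<Rightarrow> real^'n) \<Rightarrow> (real \<times> (real^'n)) measure" where
  "hyp_polar_law \<kappa> M R U =
    distr M (restrict_space borel (hyp_space \<kappa>)) (\<lambda>\<omega>. hyp_polar \<kappa> (R \<omega>) (U \<omega>))"

text \<open>
  Independence of the generated sigma-algebras. The library's \<^const>\<open>prob_space.indep_var\<close> asks for
  two random variables with values in the same type.
\<close>

definition indep_rv ::
    "'a measure \<Rightarrow> 'b measure \<Rightarrow> ('a \<Rightarrow> 'b) \<Rightarrow> 'c measure \<Rightarrow> ('a \<Rightarrow> 'c) \<Rightarrow> bool" where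
  "indep_rv M S X T Y \<longleftrightarrow>
    prob_space.indep_set M (sets (vimage_algebra (space M) X S)) (sets (vimage_algebra (space M) Y T))"

lemma indep_rv_iff_indep_var:
  assumes "prob_space M" "X \<in> M \<rightarrow>\<^sub>M S" "Y \<in> M \<rightarrow>\<^sub>M T"
  shows "indep_rv M S X T Y \<longleftrightarrow> prob_space.indep_var M S X T Y"
  using assms(2,3)
  unfolding indep_rv_def prob_space.indep_var_eq[OF assms(1)] sets_vimage_algebra by simp

lemma normalize_measurable:
  "(\<lambda>x. x /\<^sub>R norm x) \<in> restrict_space lborel (ball 0 1 - {0}) \<rightarrow>\<^sub>M (sphere_borel :: (real^'n) measure)"
  by (intro measurable_restrict_space2 measurable_restrict_space1)
     (auto simp: space_restrict_space)

lemma prob_space_unif_sphere: "prob_space (unif_sphere :: (real^'n) measure)"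
proof -
  let ?B = "ball 0 1 - {0} :: (real^'n) set"
  have "emeasure lborel ?B = emeasure lborel (ball 0 1 :: (real^'n) set)"
    by (rule emeasure_Diff_null_set) auto
  then have "emeasure (restrict_space lborel ?B) ?B = ennreal (unit_ball_vol (real CARD('n)))"
    by (subst emeasure_restrict_space) (auto simp: emeasure_ball)
  then have "prob_space (uniform_measure (restrict_space lborel ?B) ?B)"
    by (intro prob_space_uniform_measure) (auto simp: ennreal_eq_0_iff unit_ball_vol_pos not_le)
  then show ?thesis
    unfolding unif_sphere_def Let_def
    by (rule prob_space.prob_space_distr)
       (simp add: normalize_measurable measurable_cong_sets[OF sets_uniform_measure refl])
qed

lemma hyp_dist_measurable:
  "(\<lambda>x. hyp_dist \<kappa> x y) \<in> borel_measurable (hyp_polar_law \<kappa>' M R U)"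
proof -
  have l: "(\<lambda>x. lorentz x y) \<in> borel_measurable borel"
    unfolding lorentz_def by (intro borel_measurable_continuous_onI continuous_intros)
  have "(\<lambda>x. hyp_dist \<kappa> x y) \<in> borel_measurable borel"
    unfolding hyp_dist_def arcosh_def
    by (intro borel_measurable_divide borel_measurable_ln borel_measurable_add powr_real_measurable
          borel_measurable_diff borel_measurable_power borel_measurable_times borel_measurable_const l)
  then show ?thesis
    unfolding hyp_polar_law_def by (simp add: measurable_restrict_space1)
qed

lemma prob_space_hyp_polar_law:
  assumes "prob_space M" "\<kappa> > 0" "R \<in> borel_measurable M" "U \<in> M \<rightarrow>\<^sub>M sphere_borel"
  shows "prob_space (hyp_polar_law \<kappa> M R U)"
proof -
  have U: "U \<in> borel_measurable M" "\<And>\<omega>. \<omega> \<in> space M \<Longrightarrow> norm (U \<omega>) = 1"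
    using assms(4) measurable_space[OF assms(4)]
    by (auto simp: measurable_restrict_space2_iff space_restrict_space)
  have c: "(\<lambda>x::real. cosh x) \<in> borel_measurable borel" "(\<lambda>x::real. sinh x) \<in> borel_measurable borel"
    by (intro borel_measurable_continuous_onI continuous_intros; simp)+
  have "(\<lambda>\<omega>. hyp_polar \<kappa> (R \<omega>) (U \<omega>)) \<in> borel_measurable M"
    unfolding hyp_polar_def
    by (intro borel_measurable_Pair borel_measurable_scaleR borel_measurable_divide
          borel_measurable_const U(1) measurable_compose[OF _ c(1)] measurable_compose[OF _ c(2)]
          borel_measurable_times assms(3))
  then show ?thesis
    unfolding hyp_polar_law_def using assms(1,2) U(2)
    by (intro prob_space.prob_space_distr measurable_restrict_space2)
       (auto intro: hyp_polar_in_hyp_space)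
qed


subsection \<open>Dimensionless parameters\<close>

definition coth :: "real \<Rightarrow> real" where
  "coth x = cosh x / sinh x"

definition A_fun :: "real \<Rightarrow> real" where
  "A_fun s = s * coth s"

definition tau_par :: "real \<Rightarrow> real \<Rightarrow> real" where
  "tau_par \<rho> \<epsilon> = \<epsilon> / \<rho>"

definition s_par :: "real \<Rightarrow> real \<Rightarrow> real" where
  "s_par \<kappa> \<rho> = \<kappa> * \<rho>"

definition chi_par :: "real \<Rightarrow> real \<Rightarrow> real" where
  "chi_par \<kappa> \<rho> = (s_par \<kappa> \<rho>)\<^sup>2"

lemma chi_par_eq: "chi_par \<kappa> \<rho> = \<kappa>\<^sup>2 * \<rho>\<^sup>2"
  unfolding chi_par_def s_par_def by (rule power_mult_distrib)

definition lambda_par :: "nat \<Rightarrow> real \<Rightarrow> real \<Rightarrow> real \<Rightarrow> real" where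
  "lambda_par d \<kappa> \<rho> \<epsilon> = sqrt (real d) * tau_par \<rho> \<epsilon> * A_fun (s_par \<kappa> \<rho>)"

end

theory Submission
  imports Defs
begin

text \<open>
  The label of a query records only which prototypes maximise the distance to it, so it depends on
  the metric through the order of its values alone. Every strictly increasing transformation of
  the metric, in particular a change of length unit, therefore preserves the label pointwise, and
  with it the entropy of any law of queries and prototypes. The parameters are invariant because
  \<open>\<tau>\<close> is a quotient of two lengths and \<open>s\<close> is a product of a curvature scale, an inverse
  length, with a length; \<open>\<chi>\<close> and \<open>\<lambda>\<close> depend, in a fixed dimension,
  on \<open>\<tau>\<close> and \<open>s\<close> alone.
\<close>

lemma farthest_set_strict_mono:
  assumes "strict_mono f"
  shows "farthest_set (\<lambda>x y. f (d x y)) = farthest_set d"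
  by (intro ext) (simp add: farthest_set_eq strict_mono_less_eq[OF assms])

lemma H3_strict_mono:
  assumes "strict_mono f"
  shows "H3 P (\<lambda>x y. f (d x y)) = H3 P d"
  unfolding H3_def cell_prob_def label_law_def farthest_label_def
    farthest_set_strict_mono[OF assms] ..

lemma tau_par_scale: "c \<noteq> 0 \<Longrightarrow> tau_par (c * \<rho>) (c * \<epsilon>) = tau_par \<rho> \<epsilon>"
  by (simp add: tau_par_def)

lemma s_par_scale: "c \<noteq> 0 \<Longrightarrow> s_par (\<kappa> / c) (c * \<rho>) = s_par \<kappa> \<rho>"
  by (simp add: s_par_def)

theorem proposition4:
  fixes M :: "'a measure"
    and R :: "'a \<Rightarrow> real"
    and U :: "'a \<Rightarrow> real^'n"
    and P :: "(real \<times> (real^'n)) measure"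
    and dst dst' :: "real \<times> (real^'n) \<Rightarrow> real \<times> (real^'n) \<Rightarrow> real"
    and \<kappa> \<rho> \<epsilon> c \<kappa>' \<rho>' \<epsilon>' :: real
  assumes "prob_space M"
    and "\<kappa> > 0"
    and "R \<in> borel_measurable M"
    and "AE \<omega> in M. R \<omega> > 0"
    and "integrable M R"
    and "integrable M (\<lambda>\<omega>. (R \<omega>)\<^sup>2)"
    and "U \<in> M \<rightarrow>\<^sub>M sphere_borel"
    and "distr M sphere_borel U = unif_sphere"
    and "indep_rv M borel R sphere_borel U"
    and "dst = hyp_dist \<kappa>"
    and "P = hyp_polar_law \<kappa> M R U"
    and "\<rho> = prob_space.expectation M R"
    and "\<epsilon> = sqrt (prob_space.variance M R)"
    and "c > 0"
    and "dst' = (\<lambda>x y. c * dst x y)"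
    and "\<rho>' = c * \<rho>"
    and "\<epsilon>' = c * \<epsilon>"
    and "\<kappa>' = \<kappa> / c"
  shows "H3 P dst' = H3 P dst
    \<and> tau_par \<rho>' \<epsilon>' = tau_par \<rho> \<epsilon>
    \<and> s_par \<kappa>' \<rho>' = s_par \<kappa> \<rho>
    \<and> chi_par \<kappa>' \<rho>' = chi_par \<kappa> \<rho>
    \<and> lambda_par CARD('n) \<kappa>' \<rho>' \<epsilon>' = lambda_par CARD('n) \<kappa> \<rho> \<epsilon>"
proof -
  have "strict_mono (\<lambda>t. c * t)"
    using \<open>c > 0\<close> by (intro strict_monoI) simp
  then have "H3 P dst' = H3 P dst"
    unfolding \<open>dst' = _\<close> by (rule H3_strict_mono)
  moreover have "tau_par \<rho>' \<epsilon>' = tau_par \<rho> \<epsilon>"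
    using \<open>c > 0\<close> unfolding \<open>\<rho>' = _\<close> \<open>\<epsilon>' = _\<close> by (intro tau_par_scale) simp
  moreover have "s_par \<kappa>' \<rho>' = s_par \<kappa> \<rho>"
    using \<open>c > 0\<close> unfolding \<open>\<rho>' = _\<close> \<open>\<kappa>' = _\<close> by (intro s_par_scale) simp
  ultimately show ?thesis
    by (simp add: chi_par_def lambda_par_def)
qed

end
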